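(* Let $t\ge1$ be an integer and let $m(t)=\max\{|\lambda|:\lambda\in\mathcal{DS}(t)\}$. Then $m(1)=0$, $m(2)=1$, $m(t)=2t-1$ for $3\le t\le5$, and for $t\ge6$, writing $r=\lfloor\frac{2t+1}{12}\rfloor$, the following hold. (1) If either $t$ is even and $\frac t2-1-2r\equiv0\pmod 3$, or $t$ is odd and $\frac{t-1}{2}-2r\equiv2\pmod3$, then $$m(t)=\tfrac13(t-1)(t+1-4r)+r(2t+1-2r).$$ (2) If either $t$ is even and $\frac t2-1-2r\equiv1\pmod 3$, or $t$ is odd and $\frac{t-1}{2}-2r\equiv0\pmod3$, then $$m(t)=\tfrac13(t-1)(t-7-4r)+(r+2)(2t-3-2r).$$ (3) If either $t$ is even and $\frac t2-1-2r\equiv2\pmod 3$, or $t$ is odd and $\frac{t-1}{2}-2r\equiv1\pmod3$, then $$m(t)=\tfrac13(t-1)(t-3-4r)+(r+1)(2t-1-2r).$$ (4) There is exactly one partition $\lambda\in\mathcal{DS}(t)$ with $|\lambda|=m(t)$.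
   Context: A partition $\lambda=(\lambda_1,\dots,\lambda_m)$ is a finite non-increasing sequence of positive integers; $|\lambda|=\sum_i\lambda_i$ is its size; the empty partition has size $0$. The hook length of box $(i,j)$ of the Young diagram is the number of boxes to its right in row $i$, plus the number below it in column $j$, plus one. $\lambda$ is a $t$-core if no hook length is divisible by $t$; a $(t,t+1)$-core if it is both a $t$-core and a $(t+1)$-core. $\lambda$ is self-conjugate if its Young diagram is symmetric about the main diagonal. The Durfee square size $s(\lambda)$ is the largest $s$ such that $\lambda$ has at least $s$ parts $\ge s$. $\mathcal{DS}(t)$ is the set of self-conjugate $(t,t+1)$-core partitions $\lambda$ whose first $s(\lambda)$ parts are pairwise distinct; by convention $\emptyset\in\mathcal{DS}(t)$. $\lfloor x\rfloor$ is the largest integer not exceeding $x$. *)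

theory Defs
  imports Complex_Main "HOL-Number_Theory.Cong"
begin

definition is_partition :: "nat list \<Rightarrow> bool" where
  "is_partition l \<longleftrightarrow> sorted_wrt (\<ge>) l \<and> (\<forall>x\<in>set l. x > 0)"

(* Rows and columns are indexed from 0. *)
definition young_diagram :: "nat list \<Rightarrow> (nat \<times> nat) set" where
  "young_diagram l = {(i, j). i < length l \<and> j < l ! i}"

definition hook_length :: "nat list \<Rightarrow> nat \<Rightarrow> nat \<Rightarrow> nat" where
  "hook_length l i j =
     card {j'. j < j' \<and> (i, j') \<in> young_diagram l} +
     card {i'. i < i' \<and> (i', j) \<in> young_diagram l} + 1"

definition is_core :: "nat \<Rightarrow> nat list \<Rightarrow> bool" where
  "is_core t l \<longleftrightarrow> (\<forall>(i, j)\<in>young_diagram l. \<not> t dvd hook_length l i j)"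

definition self_conjugate :: "nat list \<Rightarrow> bool" where
  "self_conjugate l \<longleftrightarrow> (young_diagram l)\<inverse> = young_diagram l"

definition durfee :: "nat list \<Rightarrow> nat" where
  "durfee l = (GREATEST s. s \<le> card {i. i < length l \<and> s \<le> l ! i})"

definition DS :: "nat \<Rightarrow> nat list set" where
  "DS t = {l. is_partition l \<and> self_conjugate l \<and> is_core t l \<and> is_core (t + 1) l \<and>
              distinct (take (durfee l) l)}"

definition max_size :: "nat \<Rightarrow> nat" where
  "max_size t = Max (sum_list ` DS t)"

end

theory Submission
  imports Defs
begin

text \<open>A self-conjugate partition is determined by the set \<open>A\<close> of the positive values among
  \<open>\<lambda>\<^sub>i - i\<close> (rows indexed from \<open>0\<close>), and its size is the sum of \<open>2 a - 1\<close> over \<open>a \<in> A\<close>.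
  Together, the two core conditions and the distinctness of the first parts say that
  \<open>A \<subseteq> {1..t}\<close>, that \<open>A\<close> has no two consecutive elements, and that no \<open>a, b \<in> A\<close> (possibly equal)
  have \<open>a + b \<in> {t + 1, t + 2}\<close>.

  Arranging \<open>{1..t}\<close> in the zigzag order \<open>1, t, 2, t - 1, 3, \<dots>\<close> turns these conditions into a
  single one: the chosen positions lie in \<open>{1..<t}\<close> and are pairwise at distance at least \<open>3\<close>.
  Position \<open>p\<close> carries weight \<open>p\<close> if \<open>p\<close> is odd and \<open>2 t + 1 - p\<close> if \<open>p\<close> is even. Local exchanges
  show that a set of maximal weight consists of \<open>2, 6, \<dots>, 4 R - 2\<close> followed by
  \<open>4 R + 1, 4 R + 4, \<dots>, t - 1\<close> for some \<open>R \<equiv> t + 1\<close> modulo \<open>3\<close>. The weight of such a set is a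
  quadratic polynomial in \<open>R\<close> with vertex \<open>(2 t + 7) / 12\<close>, and a parity argument excludes ties.\<close>

section \<open>Self-conjugate partitions and their diagonals\<close>

text \<open>Padding with zeros makes this total, so that \<open>j < row l i\<close> expresses
  membership of a cell for all indices and self-conjugacy becomes symmetry of a relation.\<close>

definition row :: "nat list \<Rightarrow> nat \<Rightarrow> nat" where
  "row l i = (if i < length l then l ! i else 0)"

lemma row_antimono: "is_partition l \<Longrightarrow> i \<le> j \<Longrightarrow> row l j \<le> row l i"
  unfolding row_def is_partition_def sorted_wrt_iff_nth_less
  by (cases "i = j") auto

lemma row_pos_iff: "is_partition l \<Longrightarrow> 0 < row l i \<longleftrightarrow> i < length l"
  unfolding row_def is_partition_def by auto

lemma in_young_diagram_iff: "(i, j) \<in> young_diagram l \<longleftrightarrow> j < row l i"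
  by (auto simp: young_diagram_def row_def)

lemma self_conjugate_iff: "self_conjugate l \<longleftrightarrow> (\<forall>i j. j < row l i \<longleftrightarrow> i < row l j)"
  unfolding self_conjugate_def set_eq_iff by (auto simp: in_young_diagram_iff)

lemma row_sym: "self_conjugate l \<Longrightarrow> j < row l i \<longleftrightarrow> i < row l j"
  by (simp add: self_conjugate_iff)

lemma hook_length_eq:
  assumes "self_conjugate l" "j < row l i"
  shows "int (hook_length l i j) = int (row l i) - int i + (int (row l j) - int j) - 1"
proof -
  have "{j'. j < j' \<and> (i, j') \<in> young_diagram l} = {j<..<row l i}"
    by (auto simp: in_young_diagram_iff)
  moreover have "{i'. i < i' \<and> (i', j) \<in> young_diagram l} = {i<..<row l j}"
    using row_sym[OF assms(1)] by (auto simp: in_young_diagram_iff)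
  moreover have "i < row l j" using assms row_sym by blast
  ultimately show ?thesis using assms(2) by (simp add: hook_length_def)
qed

text \<open>The hook length of a cell \<open>(i, j)\<close> of a self-conjugate partition is \<open>x + y - 1\<close>, where
  \<open>x\<close> and \<open>y\<close> are the elements of \<open>maya l\<close> coming from rows \<open>i\<close> and \<open>j\<close>.\<close>

definition maya :: "nat list \<Rightarrow> int set" where
  "maya l = range (\<lambda>i. int (row l i) - int i)"

text \<open>If the cell \<open>(i, j)\<close> lies in the diagram, symmetry makes the values of rows
  \<open>i\<close> and \<open>j\<close> add up to at least 2; otherwise they add up to at most 0.
  Hence the sum is never 1. Conversely, the mirror image of a vacant positive place is filled by a
  column, which symmetry turns into a row.\<close>

lemma maya_reflect:
  assumes p: "is_partition l" and s: "self_conjugate l"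
  shows "1 - x \<in> maya l \<longleftrightarrow> x \<notin> maya l"
proof -
  have disjoint: False if "x \<in> maya l" "1 - x \<in> maya l" for x
  proof -
    from that obtain i j where "x = int (row l i) - int i" "1 - x = int (row l j) - int j"
      by (auto simp: maya_def)
    then show False using row_sym[OF s, of j i] by linarith
  qed
  have cover: "1 - x \<in> maya l" if x: "0 < x" "x \<notin> maya l" for x
  proof -
    define S where "S = {i. x < int (row l i) - int i}"
    have down: "j \<in> S" if "i \<in> S" "j \<le> i" for i j
      using that row_antimono[OF p that(2)] by (auto simp: S_def)
    have "length l \<notin> S" using x by (auto simp: S_def row_def)
    then obtain k where k: "k \<notin> S" "\<And>i. i < k \<Longrightarrow> i \<in> S"
      using exists_least_iff[of "\<lambda>i. i \<notin> S"] by blast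
    have S: "i \<in> S \<longleftrightarrow> i < k" for i using k down by (meson not_le)
    \<comment> \<open>Exactly the first \<open>k\<close> rows reach column \<open>m\<close>, because
      no row has the value \<open>x\<close> itself. By symmetry row \<open>m\<close> has length
      \<open>k\<close>, and \<open>k - m = 1 - x\<close>.\<close>
    define m where "m = k + nat x - 1"
    have m: "int m = int k + x - 1" using x by (simp add: m_def)
    have "j < row l m \<longleftrightarrow> j < k" for j
    proof (cases "j < k")
      case True
      then have "k - 1 \<in> S" "row l (k - 1) \<le> row l j"
        using S[of "k - 1"] row_antimono[OF p, of j "k - 1"] by auto
      then have "m < row l j" using m True by (auto simp: S_def)
      then show ?thesis using True row_sym[OF s] by blast
    next
      case False
      then have "k \<notin> S" "row l j \<le> row l k" using S[of k] row_antimono[OF p, of k j] by auto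
      moreover have "x \<noteq> int (row l k) - int k" using x by (auto simp: maya_def)
      ultimately have "\<not> m < row l j" using m False by (auto simp: S_def)
      then show ?thesis using False row_sym[OF s] by blast
    qed
    then have "row l m = k" by (meson less_irrefl linorder_neqE_nat)
    then have "1 - x = int (row l m) - int m" using m by simp
    then show ?thesis by (auto simp: maya_def)
  qed
  have "x \<in> maya l \<or> 1 - x \<in> maya l"
    using cover[of x] cover[of "1 - x"] by (cases "0 < x") auto
  then show ?thesis using disjoint by blast
qed

text \<open>A missing \<open>x - t\<close> reflects to an element \<open>y\<close> with
  \<open>x + y - 1 = t\<close>, which is the hook length of a cell. Conversely, closure under
  subtracting \<open>t\<close> extends to all multiples of \<open>t\<close>, so a hook length
  \<open>k * t\<close> would put both \<open>y\<close> and \<open>1 - y\<close> into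
  \<open>maya l\<close>.\<close>

lemma is_core_iff_maya:
  assumes p: "is_partition l" and s: "self_conjugate l" and t: "t \<ge> 1"
  shows "is_core t l \<longleftrightarrow> (\<forall>x\<in>maya l. x - int t \<in> maya l)"
proof
  assume core: "is_core t l"
  show "\<forall>x\<in>maya l. x - int t \<in> maya l"
  proof (rule ccontr)
    assume "\<not> ?thesis"
    then obtain x where x: "x \<in> maya l" "x - int t \<notin> maya l" by blast
    then have "1 - (x - int t) \<in> maya l" using maya_reflect[OF p s] by blast
    then obtain i j where ij: "x = int (row l i) - int i" "1 - (x - int t) = int (row l j) - int j"
      using x by (auto simp: maya_def)
    then have "j < row l i" using row_sym[OF s, of j i] t by linarith
    moreover from this have "hook_length l i j = t" using hook_length_eq[OF s, of j i] ij by linarith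
    ultimately show False using core unfolding is_core_def in_young_diagram_iff
      by (metis (no_types, lifting) case_prodD dvd_refl in_young_diagram_iff)
  qed
next
  assume closed: "\<forall>x\<in>maya l. x - int t \<in> maya l"
  have iter: "x - int (k * t) \<in> maya l" if "x \<in> maya l" for x k
  proof (induction k)
    case (Suc k)
    then have "x - int (k * t) - int t \<in> maya l" using closed by blast
    then show ?case by (simp add: algebra_simps)
  qed (use that in simp)
  show "is_core t l"
    unfolding is_core_def
  proof (clarsimp simp: in_young_diagram_iff)
    fix i j assume ij: "j < row l i" "t dvd hook_length l i j"
    then obtain k where k: "hook_length l i j = k * t" by (metis dvd_def mult.commute)
    let ?x = "int (row l j) - int j"
    have "?x \<in> maya l" "int (row l i) - int i \<in> maya l" by (auto simp: maya_def)
    moreover have "int (row l i) - int i - int (k * t) = 1 - ?x"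
      using hook_length_eq[OF s ij(1)] k by linarith
    ultimately show False using iter maya_reflect[OF p s] by metis
  qed
qed

section \<open>The core conditions on the diagonal\<close>

text \<open>By reflection this positive half determines all of \<open>maya l\<close>. Its elements
  \<open>x\<close> belong to the diagonal cells, whose hook lengths are
  \<open>2 * x - 1\<close>.\<close>

definition diag :: "nat list \<Rightarrow> nat set" where
  "diag l = {x. 0 < x \<and> int x \<in> maya l}"

lemma mem_diag_iff: "x \<in> diag l \<longleftrightarrow> 0 < x \<and> (\<exists>i. row l i = i + x)"
proof -
  have "int x = int (row l i) - int i \<longleftrightarrow> row l i = i + x" for i by linarith
  then show ?thesis by (simp add: diag_def maya_def image_iff)
qed

text \<open>For \<open>0 < x\<close> and \<open>x - t\<close> not positive, reflection turns the
  presence of \<open>x - t\<close> into the absence of \<open>t + 1 - x\<close>, which is the sum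
  condition.\<close>

lemma is_core_iff_diag:
  assumes p: "is_partition l" and s: "self_conjugate l" and t: "t \<ge> 1"
  shows "is_core t l \<longleftrightarrow>
    (\<forall>x\<in>diag l. (t < x \<longrightarrow> x - t \<in> diag l) \<and> (\<forall>y\<in>diag l. x + y \<noteq> t + 1))"
  unfolding is_core_iff_maya[OF assms]
proof
  assume closed: "\<forall>x\<in>maya l. x - int t \<in> maya l"
  show "\<forall>x\<in>diag l. (t < x \<longrightarrow> x - t \<in> diag l) \<and> (\<forall>y\<in>diag l. x + y \<noteq> t + 1)"
  proof (intro ballI conjI impI notI)
    fix x assume "x \<in> diag l" "t < x"
    then show "x - t \<in> diag l" using closed by (auto simp: diag_def of_nat_diff)
  next
    fix x y assume xy: "x \<in> diag l" "y \<in> diag l" "x + y = t + 1"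
    then have "1 - int y = int x - int t" by linarith
    moreover have "int x - int t \<in> maya l" using closed xy by (auto simp: diag_def)
    ultimately have "1 - int y \<in> maya l" by simp
    then show False using maya_reflect[OF p s, of "int y"] xy(2) by (simp add: diag_def)
  qed
next
  assume *: "\<forall>x\<in>diag l. (t < x \<longrightarrow> x - t \<in> diag l) \<and> (\<forall>y\<in>diag l. x + y \<noteq> t + 1)"
  have nat_diag: "nat x \<in> diag l \<longleftrightarrow> x \<in> maya l" if "0 < x" for x
    using that by (auto simp: diag_def)
  show "\<forall>x\<in>maya l. x - int t \<in> maya l"
  proof (rule ballI, rule ccontr)
    fix x assume x: "x \<in> maya l" "x - int t \<notin> maya l"
    then have y: "1 - (x - int t) \<in> maya l" using maya_reflect[OF p s] by blast
    consider "x > int t" | "0 < x" "x \<le> int t" | "x \<le> 0" by linarith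
    then show False
    proof cases
      case 1
      then have "nat x - t \<in> diag l" using * x nat_diag[of x] by auto
      then show False using x 1 by (auto simp: diag_def of_nat_diff)
    next
      case 2
      then have "nat x \<in> diag l" "nat (1 - (x - int t)) \<in> diag l"
        using x y nat_diag by auto
      moreover have "nat x + nat (1 - (x - int t)) = t + 1" using 2 by linarith
      ultimately show False using * by blast
    next
      \<comment> \<open>Here the mirror image \<open>1 - x + t\<close> of the missing element
        exceeds \<open>t\<close>, so the subtraction clause yields \<open>1 - x\<close>, the mirror
        image of \<open>x\<close> itself.\<close>
      case 3
      have "1 - x \<notin> maya l" using maya_reflect[OF p s] x by blast
      moreover have "nat (1 - (x - int t)) \<in> diag l" using y 3 nat_diag by auto
      then have "nat (1 - (x - int t)) - t \<in> diag l" using * 3 by auto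
      then have "int (nat (1 - (x - int t)) - t) \<in> maya l" unfolding diag_def by blast
      moreover have "int (nat (1 - (x - int t)) - t) = 1 - x" using 3 by linarith
      ultimately show False by metis
    qed
  qed
qed

section \<open>Durfee square, repeated parts and size\<close>

text \<open>Rows weakly decrease while indices grow, so the rows that meet the diagonal form an
  initial segment; its length \<open>D\<close> is the greatest \<open>s\<close> in the counting
  definition.\<close>

lemma durfee_iff:
  assumes p: "is_partition l"
  shows "i < durfee l \<longleftrightarrow> i < row l i"
proof -
  let ?c = "\<lambda>s. card {i. i < length l \<and> s \<le> l ! i}"
  have down: "i < row l i" if "j < row l j" "i \<le> j" for i j
    using that row_antimono[OF p that(2)] by linarith
  have "\<not> length l < row l (length l)" by (simp add: row_def)
  then obtain D where D0: "\<not> D < row l D" "\<And>i. i < D \<Longrightarrow> i < row l i"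
    using exists_least_iff[of "\<lambda>i. \<not> i < row l i"] by blast
  have D: "i < D \<longleftrightarrow> i < row l i" for i using D0 down by (meson not_le)
  have "durfee l = D"
    unfolding durfee_def
  proof (rule Greatest_equality)
    have "{..<D} \<subseteq> {i. i < length l \<and> D \<le> l ! i}"
    proof
      fix i assume "i \<in> {..<D}"
      then have "D - 1 < row l (D - 1)" "row l (D - 1) \<le> row l i"
        using D[of "D - 1"] row_antimono[OF p, of i "D - 1"] by auto
      then have "D \<le> row l i" "0 < D" using \<open>i \<in> {..<D}\<close> by auto
      then show "i \<in> {i. i < length l \<and> D \<le> l ! i}" by (auto simp: row_def split: if_splits)
    qed
    then have "card {..<D} \<le> ?c D" by (intro card_mono) auto
    then show "D \<le> ?c D" by simp
  next
    fix s assume s: "s \<le> ?c s"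
    show "s \<le> D"
    proof (rule ccontr)
      assume "\<not> s \<le> D"
      have "{i. i < length l \<and> s \<le> l ! i} \<subseteq> {..<s - 1}"
      proof
        fix i assume i: "i \<in> {i. i < length l \<and> s \<le> l ! i}"
        show "i \<in> {..<s - 1}"
        proof (rule ccontr)
          assume "i \<notin> {..<s - 1}"
          then have "row l i \<le> row l (s - 1)" using row_antimono[OF p, of "s - 1" i] by auto
          moreover have "s \<le> row l i" using i by (simp add: row_def)
          ultimately have "s - 1 < row l (s - 1)" using \<open>\<not> s \<le> D\<close> by linarith
          then show False using D[of "s - 1"] \<open>\<not> s \<le> D\<close> by auto
        qed
      qed
      then have "?c s \<le> card {..<s - 1}" by (intro card_mono) auto
      then show False using s \<open>\<not> s \<le> D\<close> by simp
    qed
  qed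
  then show ?thesis using D by simp
qed

text \<open>Two equal rows inside the Durfee square force two adjacent equal rows there, whose
  diagonal values differ by one. Conversely, \<open>x\<close> and \<open>Suc x\<close> can only come
  from adjacent rows, which then have equal length.\<close>

lemma distinct_take_durfee_iff:
  assumes p: "is_partition l"
  shows "distinct (take (durfee l) l) \<longleftrightarrow> (\<forall>x\<in>diag l. Suc x \<notin> diag l)"
proof -
  let ?D = "durfee l"
  have D: "i < ?D \<longleftrightarrow> i < row l i" for i by (rule durfee_iff[OF p])
  have len: "?D \<le> length l" using D[of "length l"] by (simp add: row_def)
  have "distinct (take ?D l) \<longleftrightarrow> (\<forall>i<?D. \<forall>j<?D. i \<noteq> j \<longrightarrow> row l i \<noteq> row l j)"
    using len by (auto simp: distinct_conv_nth row_def min_def)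
  also have "\<dots> \<longleftrightarrow> (\<forall>x\<in>diag l. Suc x \<notin> diag l)"
  proof (intro iffI allI impI ballI notI)
    fix x assume d: "\<forall>i<?D. \<forall>j<?D. i \<noteq> j \<longrightarrow> row l i \<noteq> row l j" "x \<in> diag l" "Suc x \<in> diag l"
    then obtain i j where ij: "0 < x" "row l i = i + x" "row l j = j + Suc x"
      by (auto simp: mem_diag_iff)
    then have "i = j + 1" using row_antimono[OF p, of i j] row_antimono[OF p, of "j + 1" i]
        row_antimono[OF p, of j "j + 1"] by (cases "i \<le> j") auto
    moreover from this have "i < ?D" "j < ?D" using D ij by auto
    moreover have "row l i = row l j" "i \<noteq> j" using ij \<open>i = j + 1\<close> by auto
    ultimately show False using d(1) by blast
  next
    fix i j assume *: "\<forall>x\<in>diag l. Suc x \<notin> diag l" "i < ?D" "j < ?D" "i \<noteq> j" "row l i = row l j"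
    have False if "i < j" "j < ?D" "row l i = row l j" for i j
    proof -
      have "row l (Suc i) = row l i"
        using row_antimono[OF p, of i "Suc i"] row_antimono[OF p, of "Suc i" j] that by auto
      moreover have "Suc i < row l (Suc i)" using that D[of "Suc i"] by auto
      ultimately have "row l (Suc i) = Suc i + (row l (Suc i) - Suc i)"
        "row l i = i + Suc (row l (Suc i) - Suc i)" "0 < row l (Suc i) - Suc i" by auto
      then have "row l (Suc i) - Suc i \<in> diag l" "Suc (row l (Suc i) - Suc i) \<in> diag l"
        unfolding mem_diag_iff by blast+
      then show False using * by blast
    qed
    then show False using * by (metis linorder_neqE_nat)
  qed
  finally show ?thesis .
qed

text \<open>The diagram is cut into its principal hooks \<open>H d\<close>, each with equal arm and
  leg.\<close>

lemma sum_list_eq_diag: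
  assumes p: "is_partition l" and s: "self_conjugate l"
  shows "sum_list l = (\<Sum>x\<in>diag l. 2 * x - 1)"
proof -
  let ?D = "durfee l"
  have D: "i < ?D \<longleftrightarrow> i < row l i" for i by (rule durfee_iff[OF p])
  have bij: "bij_betw (\<lambda>i. row l i - i) {..<?D} (diag l)"
    unfolding bij_betw_def
  proof
    show "inj_on (\<lambda>i. row l i - i) {..<?D}"
    proof (rule linorder_inj_onI)
      fix i j assume "i < j" "i \<in> {..<?D}" "j \<in> {..<?D}"
      then show "row l i - i \<noteq> row l j - j"
        using row_antimono[OF p, of i j] D[of i] D[of j] by auto
    qed auto
    show "(\<lambda>i. row l i - i) ` {..<?D} = diag l"
    proof (intro set_eqI iffI)
      fix x assume "x \<in> (\<lambda>i. row l i - i) ` {..<?D}"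
      then obtain i where "x = row l i - i" "i < row l i" using D by auto
      then have "0 < x" "row l i = i + x" by auto
      then show "x \<in> diag l" unfolding mem_diag_iff by blast
    next
      fix x assume "x \<in> diag l"
      then obtain i where "0 < x" "row l i = i + x" by (auto simp: mem_diag_iff)
      then show "x \<in> (\<lambda>i. row l i - i) ` {..<?D}" using D by (intro image_eqI[of _ _ i]) auto
    qed
  qed
  define H where "H d = {d} \<times> {d..<row l d} \<union> {d<..<row l d} \<times> {d}" for d
  have card_H: "card (H d) = 2 * (row l d - d) - 1" for d
    unfolding H_def by (subst card_Un_disjoint) (auto simp: card_cartesian_product)
  have Y: "young_diagram l = (\<Union>d<?D. H d)"
  proof (intro set_eqI iffI)
    fix c assume c: "c \<in> young_diagram l"
    obtain i j where ij: "c = (i, j)" by (cases c)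
    then have "j < row l i" "i < row l j" using c row_sym[OF s] by (auto simp: in_young_diagram_iff)
    then have "c \<in> H (min i j)" "min i j < row l (min i j)"
      using ij by (auto simp: H_def min_def)
    then show "c \<in> (\<Union>d<?D. H d)" using D by blast
  next
    fix c assume "c \<in> (\<Union>d<?D. H d)"
    then show "c \<in> young_diagram l" using row_sym[OF s] by (auto simp: H_def in_young_diagram_iff)
  qed
  have "sum_list l = (\<Sum>i<length l. l ! i)" by (simp add: sum_list_sum_nth atLeast0LessThan)
  also have "\<dots> = card (SIGMA i:{..<length l}. {..<l ! i})" by simp
  also have "(SIGMA i:{..<length l}. {..<l ! i}) = young_diagram l"
    by (auto simp: young_diagram_def)
  also have "card (young_diagram l) = (\<Sum>d<?D. card (H d))"
    unfolding Y by (rule card_UN_disjoint) (auto simp: H_def)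
  also have "\<dots> = (\<Sum>x\<in>diag l. 2 * x - 1)"
    using sum.reindex_bij_betw[OF bij, of "\<lambda>x. 2 * x - 1"] by (simp add: card_H)
  finally show ?thesis .
qed

section \<open>Correspondence between self-conjugate partitions and their diagonals\<close>

text \<open>At the first index of disagreement, the larger value would have to occur in the other
  sequence at an earlier index, where both sequences agree; this contradicts strictness.\<close>

lemma strict_antimono_range_eq:
  fixes f g :: "nat \<Rightarrow> int"
  assumes f: "monotone (<) (>) f" and g: "monotone (<) (>) g" and "range f = range g"
  shows "f = g"
proof
  have le: "f n \<le> g n" if f: "monotone (<) (>) f" and g: "monotone (<) (>) g" and r: "range f = range g"
    and IH: "\<And>m. m < n \<Longrightarrow> f m = g m" for f g :: "nat \<Rightarrow> int" and n
  proof (rule ccontr)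
    assume "\<not> ?thesis"
    then have "g n < f n" by simp
    moreover obtain m where m: "f n = g m" using r by (metis rangeE rangeI)
    ultimately have "m < n" using g by (metis monotoneD not_less_iff_gr_or_eq)
    then have "f m = f n" using IH m by simp
    then show False using f \<open>m < n\<close> by (metis monotoneD less_irrefl)
  qed
  fix n show "f n = g n"
  proof (induction n rule: less_induct)
    case (less n)
    then show ?case using le[of f g n] le[of g f n] assms by fastforce
  qed
qed

lemma diag_inj:
  assumes l: "is_partition l" "self_conjugate l" and k: "is_partition k" "self_conjugate k"
    and eq: "diag l = diag k"
  shows "l = k"
proof -
  have pos: "x \<in> maya l \<longleftrightarrow> x \<in> maya k" if "0 < x" for x
  proof -
    have "nat x \<in> diag l \<longleftrightarrow> nat x \<in> diag k" using eq by simp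
    then show ?thesis using that by (simp add: diag_def)
  qed
  have "x \<in> maya l \<longleftrightarrow> x \<in> maya k" for x
  proof (cases "0 < x")
    case False
    then show ?thesis
      using pos[of "1 - x"] maya_reflect[OF l, of x] maya_reflect[OF k, of x] by auto
  qed (rule pos)
  then have "maya l = maya k" by blast
  moreover have "monotone (<) (>) (\<lambda>i. int (row l i) - int i)" if "is_partition l" for l
  proof (rule monotoneI)
    fix i j :: nat assume "i < j"
    then show "int (row l j) - int j < int (row l i) - int i"
      using row_antimono[OF that, of i j] by linarith
  qed
  ultimately have "(\<lambda>i. int (row l i) - int i) = (\<lambda>i. int (row k i) - int i)"
    using l k by (intro strict_antimono_range_eq) (auto simp: maya_def)
  then have row: "row l i = row k i" for i by (metis diff_add_cancel of_nat_eq_iff)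
  then have "i < length l \<longleftrightarrow> i < length k" for i
    using row_pos_iff[OF l(1), of i] row_pos_iff[OF k(1), of i] by simp
  then have "length l = length k" by (meson less_irrefl linorder_neqE_nat)
  then show ?thesis using row by (intro nth_equalityI) (auto simp: row_def, metis)
qed

text \<open>The partition is built by wrapping a symmetric hook with arm and leg \<open>x - 1\<close> around
  the previous diagram, which has fewer than \<open>x\<close> rows.\<close>

lemma ex_self_conjugate_diag:
  assumes "finite A" "\<And>x. x \<in> A \<Longrightarrow> 0 < x"
  shows "\<exists>l. is_partition l \<and> self_conjugate l \<and> diag l = A"
proof -
  \<comment> \<open>The induction also bounds the number of rows. Quantifying over upper bounds
    \<open>b\<close> instead of using the maximum of \<open>A\<close> lets the clause cover the
    empty set.\<close>
  have "(\<forall>x\<in>A. 0 < x) \<longrightarrow> (\<exists>l. is_partition l \<and> self_conjugate l \<and> diag l = A \<and>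
    (\<forall>b>0. (\<forall>a\<in>A. a < b) \<longrightarrow> length l < b))"
    using assms(1)
  proof (induction A rule: finite_linorder_max_induct)
    case empty
    show ?case
      by (auto intro!: exI[of _ "[]"] simp: is_partition_def self_conjugate_iff mem_diag_iff row_def)
  next
    case (insert x A)
    show ?case
    proof
      assume pos: "\<forall>y\<in>insert x A. 0 < y"
      then obtain l where l: "is_partition l" "self_conjugate l" "diag l = A" "length l < x"
        using insert by auto
      define k where "k = x # map Suc l @ replicate (x - 1 - length l) 1"
      have len: "length k = x" using l(4) by (simp add: k_def)
      have row0: "row k 0 = x" using pos by (simp add: row_def k_def)
      have rowS: "row k (Suc i) = (if Suc i < x then Suc (row l i) else 0)" for i
        using l(4) by (auto simp: row_def k_def nth_append)
      \<comment> \<open>By symmetry, a row longer than \<open>length l\<close> would make the row at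
        index \<open>length l\<close> nonempty.\<close>
      have bound: "row l i < x" for i
      proof (rule ccontr)
        assume "\<not> row l i < x"
        then have "length l < row l i" using l(4) by simp
        then have "i < row l (length l)" using row_sym[OF l(2)] by blast
        then show False by (simp add: row_def)
      qed
      have "sorted_wrt (\<ge>) k" "\<forall>y\<in>set k. 0 < y"
      proof -
        have "Suc y \<le> x" if "y \<in> set l" for y
          using that bound by (metis Suc_leI in_set_conv_nth row_def)
        moreover have "sorted_wrt (\<ge>) (replicate n (1::nat))" for n by (induction n) auto
        ultimately show "sorted_wrt (\<ge>) k" "\<forall>y\<in>set k. 0 < y" using l(1) pos
          by (auto simp: k_def is_partition_def sorted_wrt_append sorted_wrt_map)
      qed
      then have "is_partition k" by (simp add: is_partition_def)
      moreover have "self_conjugate k"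
        unfolding self_conjugate_iff
      proof (intro allI)
        fix i j
        have small: "i < length l" "j < length l" if "j < row l i" for i j
          using that row_sym[OF l(2), of j i] by (auto simp: row_def split: if_splits)
        show "j < row k i \<longleftrightarrow> i < row k j"
        proof (cases i; cases j)
          fix i' j' assume "i = Suc i'" "j = Suc j'"
          then show ?thesis
            using rowS[of i'] rowS[of j'] row_sym[OF l(2), of j' i'] small[of j' i'] l(4) by auto
        qed (use row0 rowS in auto)
      qed
      moreover have "diag k = insert x A"
      proof (intro set_eqI iffI)
        fix y assume "y \<in> diag k"
        then obtain i where i: "0 < y" "row k i = i + y" by (auto simp: mem_diag_iff)
        have "y = x \<or> y \<in> diag l"
        proof (cases i)
          case (Suc j)
          then have "row l j = j + y" using i rowS[of j] by (auto split: if_splits)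
          then show ?thesis using i by (auto simp: mem_diag_iff)
        qed (use i row0 in auto)
        then show "y \<in> insert x A" using l by simp
      next
        fix y assume "y \<in> insert x A"
        then consider "y = x" | "y \<in> diag l" using l by auto
        then show "y \<in> diag k"
        proof cases
          case 1
          then show ?thesis using row0 pos by (auto simp: mem_diag_iff intro: exI[of _ 0])
        next
          case 2
          then obtain i where i: "0 < y" "row l i = i + y" by (auto simp: mem_diag_iff)
          moreover have "Suc i < x" using bound[of i] i by simp
          ultimately show ?thesis using rowS by (auto simp: mem_diag_iff intro!: exI[of _ "Suc i"])
        qed
      qed
      ultimately show "\<exists>l. is_partition l \<and> self_conjugate l \<and> diag l = insert x A \<and>
          (\<forall>b>0. (\<forall>a\<in>insert x A. a < b) \<longrightarrow> length l < b)"
        using len by auto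
    qed
  qed
  then show ?thesis using assms(2) by blast
qed

section \<open>Membership in \<open>DS\<close> as a condition on the diagonal\<close>

definition admissible :: "nat \<Rightarrow> nat set \<Rightarrow> bool" where
  "admissible t A \<longleftrightarrow> A \<subseteq> {1..t} \<and>
     (\<forall>x\<in>A. \<forall>y\<in>A. y \<noteq> Suc x \<and> x + y \<noteq> t + 1 \<and> x + y \<noteq> t + 2)"

text \<open>The bound by \<open>t\<close> arises as follows: \<open>t + 1\<close> would bring in 1,
  and these add up to \<open>t + 2\<close>; a larger \<open>x\<close> would bring in the consecutive
  values \<open>x - t - 1\<close> and \<open>x - t\<close>. Conversely, once no element exceeds
  \<open>t\<close>, nothing has to be checked for the subtraction clauses.\<close>

lemma DS_iff:
  assumes t: "t \<ge> 1"
  shows "l \<in> DS t \<longleftrightarrow> is_partition l \<and> self_conjugate l \<and> admissible t (diag l)"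
proof (cases "is_partition l \<and> self_conjugate l")
  case True
  then have p: "is_partition l" and s: "self_conjugate l" by auto
  have pos: "0 < x" if "x \<in> diag l" for x using that by (simp add: diag_def)
  show ?thesis
  proof
    assume "l \<in> DS t"
    then have c1: "\<And>x. x \<in> diag l \<Longrightarrow> t < x \<Longrightarrow> x - t \<in> diag l"
      and c2: "\<And>x y. x \<in> diag l \<Longrightarrow> y \<in> diag l \<Longrightarrow> x + y \<noteq> t + 1"
      and c3: "\<And>x. x \<in> diag l \<Longrightarrow> t + 1 < x \<Longrightarrow> x - (t + 1) \<in> diag l"
      and c4: "\<And>x y. x \<in> diag l \<Longrightarrow> y \<in> diag l \<Longrightarrow> x + y \<noteq> t + 2"
      and c5: "\<And>x. x \<in> diag l \<Longrightarrow> Suc x \<notin> diag l"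
      using is_core_iff_diag[OF p s t] is_core_iff_diag[OF p s, of "t + 1"]
        distinct_take_durfee_iff[OF p] by (auto simp: DS_def)
    have "x \<le> t" if x: "x \<in> diag l" for x
    proof (rule ccontr)
      assume "\<not> x \<le> t"
      then consider "x = t + 1" | "t + 1 < x" by linarith
      then show False
      proof cases
        case 1
        then show False using c1[OF x] c4[OF x, of 1] by simp
      next
        case 2
        then show False using c1[OF x] c3[OF x] c5[of "x - (t + 1)"] by (simp add: Suc_diff_Suc)
      qed
    qed
    then show "is_partition l \<and> self_conjugate l \<and> admissible t (diag l)"
      using p s c2 c4 c5 pos by (auto simp: admissible_def Suc_le_eq)
  next
    assume "is_partition l \<and> self_conjugate l \<and> admissible t (diag l)"
    then show "l \<in> DS t"
      using is_core_iff_diag[OF p s t] is_core_iff_diag[OF p s, of "t + 1"]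
        distinct_take_durfee_iff[OF p]
      by (fastforce simp: DS_def admissible_def)
  qed
qed (auto simp: DS_def)

section \<open>Unfolding the diagonal\<close>

definition unfold_pos :: "nat \<Rightarrow> nat \<Rightarrow> nat" where
  "unfold_pos t p = (if odd p then (p + 1) div 2 else t + 1 - p div 2)"

definition weight :: "nat \<Rightarrow> nat \<Rightarrow> nat" where
  "weight t p = (if odd p then p else 2 * t + 1 - p)"

text \<open>Position \<open>t\<close> is left out because its value \<open>a\<close> satisfies
  \<open>2 * a = t + 1\<close> or \<open>2 * a = t + 2\<close>, which is the case of two equal
  summands.\<close>

definition sparse :: "nat \<Rightarrow> nat set \<Rightarrow> bool" where
  "sparse t P \<longleftrightarrow> P \<subseteq> {1..<t} \<and> (\<forall>p\<in>P. \<forall>q\<in>P. p < q \<longrightarrow> p + 3 \<le> q)"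

text \<open>Division and truncated subtraction are traded for linear equations, so that case splits
  on parity end in linear arithmetic.\<close>

lemma unfold_pos_cases:
  assumes "p < t"
  obtains k where "p = 2 * k + 1" "unfold_pos t p = k + 1" "weight t p = p"
  | k where "p = 2 * k" "unfold_pos t p + k = t + 1" "weight t p + p = 2 * t + 1"
proof (cases "odd p")
  case True
  then obtain k where "p = 2 * k + 1" by (auto elim: oddE)
  then show ?thesis using that(1)[of k] by (simp add: unfold_pos_def weight_def)
next
  case False
  then obtain k where "p = 2 * k" by (auto elim: evenE)
  then show ?thesis using that(2)[of k] assms by (simp add: unfold_pos_def weight_def)
qed

lemma inj_on_unfold_pos: "inj_on (unfold_pos t) {1..<t}"
proof (rule inj_onI)
  fix p q assume pq: "p \<in> {1..<t}" "q \<in> {1..<t}" "unfold_pos t p = unfold_pos t q"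
  then have "p < t" "q < t" by auto
  with pq(3) show "p = q"
    by (cases rule: unfold_pos_cases[OF \<open>p < t\<close>]; cases rule: unfold_pos_cases[OF \<open>q < t\<close>])
      linarith+
qed

text \<open>Values at positions of equal parity differ by half the distance. Values at positions of
  opposite parity sum to \<open>t + 1\<close> or \<open>t + 2\<close> only when the positions are
  adjacent. Distance at least 3 therefore avoids every forbidden pair.\<close>

lemma admissible_unfold_pos:
  assumes "sparse t P"
  shows "admissible t (unfold_pos t ` P)"
proof -
  have 1: "unfold_pos t p \<in> {1..t}" if "p \<in> {1..<t}" for p
  proof -
    have "1 \<le> p" "p < t" using that by auto
    then show ?thesis by (cases rule: unfold_pos_cases[OF \<open>p < t\<close>]) auto
  qed
  have 2: "unfold_pos t q \<noteq> Suc (unfold_pos t p) \<and> unfold_pos t p + unfold_pos t q \<noteq> t + 1 \<and>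
      unfold_pos t p + unfold_pos t q \<noteq> t + 2"
    if "p \<in> {1..<t}" "q \<in> {1..<t}" "p = q \<or> p + 3 \<le> q \<or> q + 3 \<le> p" for p q
  proof (cases "p = q")
    case True
    have "1 \<le> p" "p < t" using that by auto
    then show ?thesis unfolding True[symmetric]
      by (cases rule: unfold_pos_cases[OF \<open>p < t\<close>]) (intro conjI notI; linarith)+
  next
    case False
    then have gap: "p + 3 \<le> q \<or> q + 3 \<le> p" and "p < t" "q < t" using that by auto
    then show ?thesis
      by (cases rule: unfold_pos_cases[OF \<open>p < t\<close>]; cases rule: unfold_pos_cases[OF \<open>q < t\<close>];
          intro conjI notI) linarith+
  qed
  have "p = q \<or> p + 3 \<le> q \<or> q + 3 \<le> p" if "p \<in> P" "q \<in> P" for p q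
    using that assms unfolding sparse_def by (metis linorder_neqE_nat)
  moreover have sub: "P \<subseteq> {1..<t}" using assms by (simp add: sparse_def)
  ultimately have "unfold_pos t q \<noteq> Suc (unfold_pos t p) \<and> unfold_pos t p + unfold_pos t q \<noteq> t + 1 \<and>
      unfold_pos t p + unfold_pos t q \<noteq> t + 2" if "p \<in> P" "q \<in> P" for p q
    using 2 that by blast
  moreover have "unfold_pos t ` P \<subseteq> {1..t}" using 1 sub by blast
  ultimately show ?thesis by (simp add: admissible_def)
qed

lemma admissible_imp_sparse:
  assumes "admissible t A"
  shows "\<exists>P. sparse t P \<and> A = unfold_pos t ` P"
proof (intro exI conjI)
  let ?P = "{p \<in> {1..<t}. unfold_pos t p \<in> A}"
  have A: "y \<noteq> Suc x" "x + y \<noteq> t + 1" "x + y \<noteq> t + 2" "1 \<le> x" "x \<le> t" if "x \<in> A" "y \<in> A" for x y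
    using that assms by (auto simp: admissible_def)
  have "p + 3 \<le> q" if pq: "p \<in> ?P" "q \<in> ?P" "p < q" for p q
  proof (rule ccontr)
    have "p < t" "q < t" using pq by auto
    assume "\<not> p + 3 \<le> q"
    then have "q = p + 1 \<or> q = p + 2" using pq by linarith
    then show False
    proof
      assume q: "q = p + 1"
      have "unfold_pos t p + unfold_pos t q = t + 1 \<or> unfold_pos t p + unfold_pos t q = t + 2"
      proof (cases rule: unfold_pos_cases[OF \<open>p < t\<close>])
        case (1 k)
        then have "unfold_pos t q = t - k" using q by (simp add: unfold_pos_def)
        then show ?thesis using 1 \<open>p < t\<close> by simp
      next
        case (2 k)
        then have "unfold_pos t q = k + 1" using q by (simp add: unfold_pos_def)
        then show ?thesis using 2 by simp
      qed
      then show False using pq A(2,3)[of "unfold_pos t p" "unfold_pos t q"] by blast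
    next
      assume q: "q = p + 2"
      have "unfold_pos t q = Suc (unfold_pos t p) \<or> unfold_pos t p = Suc (unfold_pos t q)"
      proof (cases rule: unfold_pos_cases[OF \<open>p < t\<close>])
        case (1 k)
        then have "unfold_pos t q = k + 2" using q by (simp add: unfold_pos_def)
        then show ?thesis using 1 by simp
      next
        case (2 k)
        then have "unfold_pos t q = t - k" using q by (simp add: unfold_pos_def)
        then have "unfold_pos t p = Suc (unfold_pos t q)" using 2 \<open>p < t\<close> by simp
        then show ?thesis ..
      qed
      then show False
        using pq A(1)[of "unfold_pos t p" "unfold_pos t q"] A(1)[of "unfold_pos t q" "unfold_pos t p"]
        by blast
    qed
  qed
  then show "sparse t ?P" by (auto simp: sparse_def)
  show "A = unfold_pos t ` ?P"
  proof
    show "A \<subseteq> unfold_pos t ` ?P"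
    proof
      fix a assume a: "a \<in> A"
      \<comment> \<open>The inverse of the zigzag: small values sit at odd positions, large ones at
        even positions. The two excluded values of \<open>2 * a\<close> are what keeps
        \<open>p\<close> below \<open>t\<close>.\<close>
      define p where "p = (if 2 * a \<le> t then 2 * a - 1 else 2 * (t + 1 - a))"
      have "p \<in> {1..<t}" "unfold_pos t p = a"
        using A[OF a a] by (auto simp: p_def unfold_pos_def)
      then show "a \<in> unfold_pos t ` ?P" using a by auto
    qed
  qed auto
qed

lemma weight_eq: "p < t \<Longrightarrow> 2 * unfold_pos t p - 1 = weight t p"
  by (cases rule: unfold_pos_cases[of p t]) auto

text \<open>A bijection that carries size to weight transfers both the maximum and the number of
  maximizers.\<close>

lemma DS_bij_sparse:
  assumes t: "t \<ge> 1"
  obtains \<phi> where "bij_betw \<phi> (DS t) {P. sparse t P}"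
    "\<And>l. l \<in> DS t \<Longrightarrow> sum_list l = sum (weight t) (\<phi> l)"
proof -
  define \<phi> where "\<phi> l = {p \<in> {1..<t}. unfold_pos t p \<in> diag l}" for l
  have phi_eq: "\<phi> l = P" if "sparse t P" "diag l = unfold_pos t ` P" for l P
  proof -
    have "P \<subseteq> {1..<t}" using that by (simp add: sparse_def)
    then have "p \<in> {1..<t} \<and> unfold_pos t p \<in> unfold_pos t ` P \<longleftrightarrow> p \<in> P" for p
      using inj_on_image_mem_iff[OF inj_on_unfold_pos] by blast
    then show ?thesis using that by (auto simp: \<phi>_def)
  qed
  have phi: "sparse t (\<phi> l)" "unfold_pos t ` \<phi> l = diag l" if l: "l \<in> DS t" for l
  proof -
    obtain P where P: "sparse t P" "diag l = unfold_pos t ` P"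
      using admissible_imp_sparse l DS_iff[OF t] by blast
    then have "\<phi> l = P" by (intro phi_eq)
    then show "sparse t (\<phi> l)" "unfold_pos t ` \<phi> l = diag l" using P by auto
  qed
  have "inj_on \<phi> (DS t)"
    using phi(2) diag_inj DS_iff[OF t] by (intro inj_onI) metis
  moreover have "P \<in> \<phi> ` DS t" if P: "sparse t P" for P
  proof -
    have "admissible t (unfold_pos t ` P)" by (rule admissible_unfold_pos[OF P])
    moreover from this have "unfold_pos t ` P \<subseteq> {1..t}" by (simp add: admissible_def)
    then have "finite (unfold_pos t ` P)" "\<And>x. x \<in> unfold_pos t ` P \<Longrightarrow> 0 < x"
      by (auto intro: finite_subset)
    then obtain l where l: "is_partition l" "self_conjugate l" "diag l = unfold_pos t ` P"
      using ex_self_conjugate_diag by blast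
    ultimately have "l \<in> DS t" using DS_iff[OF t] by simp
    moreover have "\<phi> l = P" using P l(3) by (rule phi_eq)
    ultimately show ?thesis by blast
  qed
  ultimately have "bij_betw \<phi> (DS t) {P. sparse t P}" using phi by (auto simp: bij_betw_def)
  moreover have "sum_list l = sum (weight t) (\<phi> l)" if l: "l \<in> DS t" for l
  proof -
    have sub: "\<phi> l \<subseteq> {1..<t}" by (auto simp: \<phi>_def)
    have "sum_list l = (\<Sum>x\<in>unfold_pos t ` \<phi> l. 2 * x - 1)"
      using sum_list_eq_diag l DS_iff[OF t] phi(2)[OF l] by simp
    also have "\<dots> = (\<Sum>p\<in>\<phi> l. 2 * unfold_pos t p - 1)"
      using inj_on_subset[OF inj_on_unfold_pos sub] by (simp add: sum.reindex)
    also have "\<dots> = sum (weight t) (\<phi> l)" using sub weight_eq by (intro sum.cong) auto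
    finally show ?thesis .
  qed
  ultimately show ?thesis using that by blast
qed

section \<open>Sparse sets of maximal weight\<close>

definition optimal :: "nat \<Rightarrow> nat set \<Rightarrow> bool" where
  "optimal t P \<longleftrightarrow> sparse t P \<and> (\<forall>Q. sparse t Q \<longrightarrow> sum (weight t) Q \<le> sum (weight t) P)"

lemma weight_odd: "odd p \<Longrightarrow> weight t p = p"
  and weight_even: "even p \<Longrightarrow> weight t p = 2 * t + 1 - p"
  by (simp_all add: weight_def)

lemma mod_eq_imp_gap:
  fixes p q m :: nat
  assumes "p mod m = q mod m" "p < q"
  shows "p + m \<le> q"
proof -
  obtain k where "q = p + m * k" using mod_eq_nat2E[OF assms(1)] assms(2) by (metis less_imp_le)
  then show ?thesis using assms(2) by (cases k) auto
qed

lemma four_mult_add_two_mod: "(4 * n + 2) mod 4 = (2::nat)"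
  by (subst mod_mult_self4) simp

lemma finite_sparse: "sparse t P \<Longrightarrow> finite P"
  unfolding sparse_def by (auto intro: finite_subset)

lemma finite_sparse_sets: "finite {P. sparse t P}"
  by (rule finite_subset[of _ "Pow {1..<t}"]) (auto simp: sparse_def)

lemma sparse_gap: "sparse t P \<Longrightarrow> p \<in> P \<Longrightarrow> q \<in> P \<Longrightarrow> q = p \<or> q + 3 \<le> p \<or> p + 3 \<le> q"
  unfolding sparse_def by (metis linorder_neqE_nat)

lemma ex_optimal: "\<exists>P. optimal t P"
proof -
  let ?S = "sum (weight t) ` {P. sparse t P}"
  have "finite ?S" using finite_sparse_sets by blast
  moreover have "{} \<in> {P. sparse t P}" by (simp add: sparse_def)
  ultimately have "Max ?S \<in> ?S" "\<And>Q. sparse t Q \<Longrightarrow> sum (weight t) Q \<le> Max ?S"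
    by (auto intro!: Max_in Max_ge)
  then show ?thesis unfolding optimal_def by (metis imageE mem_Collect_eq)
qed

text \<open>Trading \<open>X\<close> for \<open>Y\<close> gives another sparse set, so it cannot
  gain weight. The structural facts below each exhibit a gainful trade unless a specific neighbour
  blocks it.\<close>

lemma optimal_exchange:
  assumes opt: "optimal t P" and X: "X \<subseteq> P" and Y: "sparse t Y"
    and sep: "\<And>q y. q \<in> P - X \<Longrightarrow> y \<in> Y \<Longrightarrow> q + 3 \<le> y \<or> y + 3 \<le> q"
  shows "sum (weight t) Y \<le> sum (weight t) X"
proof -
  have P: "sparse t P" using opt by (simp add: optimal_def)
  have "p + 3 \<le> q" if "p \<in> (P - X) \<union> Y" "q \<in> (P - X) \<union> Y" "p < q" for p q
  proof -
    consider "p \<in> P" "q \<in> P" | "p \<in> Y" "q \<in> Y" | "p \<in> P - X" "q \<in> Y" | "p \<in> Y" "q \<in> P - X"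
      using \<open>p \<in> _\<close> \<open>q \<in> _\<close> by blast
    then show ?thesis
    proof cases
      case 1
      then show ?thesis using P \<open>p < q\<close> unfolding sparse_def by blast
    next
      case 2
      then show ?thesis using Y \<open>p < q\<close> unfolding sparse_def by blast
    next
      case 3
      then show ?thesis using sep[of p q] \<open>p < q\<close> by linarith
    next
      case 4
      then show ?thesis using sep[of q p] \<open>p < q\<close> by linarith
    qed
  qed
  then have "sparse t ((P - X) \<union> Y)" using P Y unfolding sparse_def by blast
  then have "sum (weight t) ((P - X) \<union> Y) \<le> sum (weight t) P"
    using opt by (simp add: optimal_def)
  moreover have "(P - X) \<inter> Y = {}"
  proof (rule ccontr)
    assume "(P - X) \<inter> Y \<noteq> {}"
    then obtain x where "x \<in> P - X" "x \<in> Y" by blast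
    then show False using sep[of x x] by simp
  qed
  then have "sum (weight t) ((P - X) \<union> Y) = sum (weight t) (P - X) + sum (weight t) Y"
    using finite_sparse[OF P] finite_sparse[OF Y] by (intro sum.union_disjoint) auto
  moreover have "sum (weight t) P = sum (weight t) (P - X) + sum (weight t) X"
    using X finite_sparse[OF P] by (simp add: sum.subset_diff)
  ultimately show ?thesis by simp
qed

section \<open>Local exchanges in a set of maximal weight\<close>

context
  fixes t :: nat and P :: "nat set"
  assumes opt: "optimal t P"
begin

lemma optimal_sparse: "sparse t P"
  using opt unfolding optimal_def by blast

lemma optimal_bounds: "p \<in> P \<Longrightarrow> 1 \<le> p \<and> p < t"
  using optimal_sparse by (auto simp: sparse_def)

lemma optimal_gap: "p \<in> P \<Longrightarrow> q \<in> P \<Longrightarrow> q = p \<or> q + 3 \<le> p \<or> p + 3 \<le> q"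
  by (rule sparse_gap[OF optimal_sparse])

lemma optimal_dominating:
  assumes "1 \<le> p" "p < t"
  shows "\<exists>q\<in>P. q < p + 3 \<and> p < q + 3"
proof (rule ccontr)
  assume none: "\<not> ?thesis"
  have "sum (weight t) {p} \<le> sum (weight t) {}"
  proof (rule optimal_exchange[OF opt])
    fix q y assume "q \<in> P - {}" "y \<in> {p}"
    then have "\<not> (q < p + 3 \<and> p < q + 3)" "y = p" using none by blast+
    then show "q + 3 \<le> y \<or> y + 3 \<le> q" by linarith
  qed (use assms in \<open>auto simp: sparse_def\<close>)
  moreover have "0 < weight t p" using assms by (auto simp: weight_def)
  ultimately show False by simp
qed

text \<open>Shifting \<open>p\<close> to the even position \<open>p + 1\<close> raises the weight
  from \<open>p\<close> to \<open>2 * t - p\<close>; only \<open>p + 3\<close> can block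
  this.\<close>

lemma optimal_after_odd:
  assumes p: "p \<in> P" "odd p" "p + 1 < t"
  shows "p + 3 \<in> P"
proof (rule ccontr)
  assume n: "p + 3 \<notin> P"
  have "sum (weight t) {p + 1} \<le> sum (weight t) {p}"
  proof (rule optimal_exchange[OF opt])
    fix q y assume "q \<in> P - {p}" "y \<in> {p + 1}"
    then show "q + 3 \<le> y \<or> y + 3 \<le> q"
      using n optimal_gap[of p q] p by (cases "q = p + 3") auto
  qed (use p in \<open>auto simp: sparse_def\<close>)
  then show False using p by (simp add: weight_odd weight_even)
qed

text \<open>Shifting both elements up by one raises the joint weight from \<open>2 * t - 2\<close>
  to \<open>2 * t + 4\<close>; only \<open>p + 6\<close> can block this.\<close>

lemma optimal_after_odd_even:
  assumes p: "p \<in> P" "odd p" "p + 3 \<in> P" "p + 4 < t"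
  shows "p + 6 \<in> P"
proof (rule ccontr)
  assume n: "p + 6 \<notin> P"
  have "sum (weight t) {p + 1, p + 4} \<le> sum (weight t) {p, p + 3}"
  proof (rule optimal_exchange[OF opt])
    fix q y assume "q \<in> P - {p, p + 3}" "y \<in> {p + 1, p + 4}"
    then show "q + 3 \<le> y \<or> y + 3 \<le> q"
      using n optimal_gap[of p q] optimal_gap[of "p + 3" q] p by (cases "q = p + 6") auto
  qed (use p in \<open>auto simp: sparse_def\<close>)
  then show False using p by (simp add: weight_odd weight_even)
qed

text \<open>Even positions lose weight as they grow, so moving to \<open>p - 2\<close> gains 2
  unless one of these two neighbours blocks it.\<close>

lemma optimal_before_even:
  assumes p: "p \<in> P" "even p" "4 \<le> p"
  shows "p - 3 \<in> P \<or> p - 4 \<in> P"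
proof (rule ccontr)
  assume n: "\<not> ?thesis"
  have b: "p < t" using optimal_bounds p by blast
  have "sum (weight t) {p - 2} \<le> sum (weight t) {p}"
  proof (rule optimal_exchange[OF opt])
    fix q y assume "q \<in> P - {p}" "y \<in> {p - 2}"
    then show "q + 3 \<le> y \<or> y + 3 \<le> q"
      using n optimal_gap[of p q] p by (cases "q = p - 3"; cases "q = p - 4") auto
  qed (use p b in \<open>auto simp: sparse_def\<close>)
  then show False using p b by (simp add: weight_even)
qed

text \<open>Moving to the even position \<open>p - 1\<close> raises the weight from \<open>p\<close>
  to \<open>2 * t + 2 - p\<close>; only \<open>p - 3\<close> can block this.\<close>

lemma optimal_before_odd:
  assumes p: "p \<in> P" "odd p" "3 \<le> p"
  shows "p - 3 \<in> P"
proof (rule ccontr)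
  assume n: "\<not> ?thesis"
  have b: "p < t" using optimal_bounds p by blast
  have "sum (weight t) {p - 1} \<le> sum (weight t) {p}"
  proof (rule optimal_exchange[OF opt])
    fix q y assume "q \<in> P - {p}" "y \<in> {p - 1}"
    then show "q + 3 \<le> y \<or> y + 3 \<le> q"
      using n optimal_gap[of p q] p by (cases "q = p - 3") auto
  qed (use p b in \<open>auto simp: sparse_def\<close>)
  then show False using p b by (simp add: weight_odd weight_even)
qed

text \<open>With odd elements excluded below \<open>b\<close>, \<open>optimal_before_even\<close>
  leaves only \<open>e - 4\<close>, and the descent ends at 2. The bound \<open>b\<close> will be
  the least odd element, or \<open>t\<close> if there is none.\<close>

lemma optimal_even_prefix:
  assumes even: "\<And>x. x \<in> P \<Longrightarrow> x < b \<Longrightarrow> even x"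
  shows "e \<in> P \<Longrightarrow> e < b \<Longrightarrow> e mod 4 = 2 \<and> (\<forall>x\<le>e. x mod 4 = 2 \<longrightarrow> x \<in> P)"
proof (induction e rule: less_induct)
  case (less e)
  have ev: "even e" using even less by blast
  show ?case
  proof (cases "4 \<le> e")
    case True
    have "odd (e - 3)" "e - 3 < b" using less.prems ev True by auto
    then have "e - 3 \<notin> P" using even[of "e - 3"] by blast
    then have "e - 4 \<in> P" using optimal_before_even[of e] less.prems ev True by blast
    then have IH: "(e - 4) mod 4 = 2" "\<And>x. x \<le> e - 4 \<Longrightarrow> x mod 4 = 2 \<Longrightarrow> x \<in> P"
      using less.IH[of "e - 4"] True less.prems by auto
    then have "e mod 4 = 2" using True by (metis le_mod_geq)
    moreover have "x \<in> P" if "x \<le> e" "x mod 4 = 2" for x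
    proof (cases "x = e")
      case False
      then have "x + 4 \<le> e" using that \<open>e mod 4 = 2\<close> by (intro mod_eq_imp_gap) auto
      then have "x \<le> e - 4" by simp
      then show ?thesis using IH that by blast
    qed (use less.prems in simp)
    ultimately show ?thesis by blast
  next
    case False
    moreover have "1 \<le> e" using optimal_bounds less.prems by blast
    ultimately have "e = 1 \<or> e = 2 \<or> e = 3" by linarith
    then have "e = 2" using ev by auto
    moreover have "x = 2" if "x \<le> 2" "x mod 4 = 2" for x :: nat using that by simp
    ultimately show ?thesis using less.prems by auto
  qed
qed

lemma optimal_chain:
  assumes p: "p \<in> P" "odd p"
  shows "p + 3 * k < t \<Longrightarrow> p + 3 * k \<in> P"
    and "\<exists>k. p + 3 * k + 1 = t"
proof -
  \<comment> \<open>Parity alternates along steps of 3, so the induction advances by 6, using the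
    two forward exchanges in turn.\<close>
  have step: "(p + 6 * m < t \<longrightarrow> p + 6 * m \<in> P) \<and> (p + 6 * m + 3 < t \<longrightarrow> p + 6 * m + 3 \<in> P)" for m
  proof (induction m)
    case 0
    then show ?case using optimal_after_odd[of p] p by auto
  next
    case (Suc m)
    have "p + 6 * m + 6 \<in> P" if "p + 6 * m + 6 < t"
      using that Suc optimal_after_odd_even[of "p + 6 * m"] p by auto
    moreover have "p + 6 * m + 9 \<in> P" if "p + 6 * m + 9 < t"
      using that calculation optimal_after_odd[of "p + 6 * m + 6"] p by (auto simp: add.assoc)
    ultimately show ?case by (auto simp: algebra_simps)
  qed
  show chain: "p + 3 * k \<in> P" if "p + 3 * k < t" for k
  proof (cases "even k")
    case True
    then obtain m where "k = 2 * m" by blast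
    then show ?thesis using step[of m] that by simp
  next
    case False
    then obtain m where "k = 2 * m + 1" by (auto elim: oddE)
    then show ?thesis using step[of m] that by (simp add: algebra_simps)
  qed
  define k where "k = (t - 1 - p) div 3"
  have k: "p + 3 * k < t" "t \<le> p + 3 * k + 3"
    using optimal_bounds[OF p(1)] by (auto simp: k_def)
  have "p + 3 * k + 1 = t"
  proof (rule ccontr)
    assume "p + 3 * k + 1 \<noteq> t"
    then have lt: "p + 3 * k + 1 < t" using k by simp
    \<comment> \<open>With room after the last chain element, the forward exchanges would demand a
      further element at or beyond \<open>t\<close>.\<close>
    have "p + 3 * k + 3 \<in> P"
    proof (cases "even k")
      case True
      then show ?thesis using optimal_after_odd[of "p + 3 * k"] chain k lt p by auto
    next
      case False
      then obtain m where m: "k = 2 * m + 1" by (auto elim: oddE)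
      then show ?thesis
        using optimal_after_odd_even[of "p + 6 * m"] chain[of "2 * m"] chain[of k] k lt p
        by (auto simp: algebra_simps)
    qed
    then show False using optimal_bounds k by fastforce
  qed
  then show "\<exists>k. p + 3 * k + 1 = t" by blast
qed

end

section \<open>The candidates for maximal weight\<close>

text \<open>The value \<open>4 * R = t + 4\<close> is allowed: it encodes the set \<open>2, 6, \<dots>, t - 2\<close> (for \<open>4\<close> dividing
  \<open>t\<close>), whose weight still follows the same quadratic formula.\<close>

definition config :: "nat \<Rightarrow> nat \<Rightarrow> nat set" where
  "config t R = {x \<in> {1..<t}. x < 4 * R \<and> x mod 4 = 2 \<or> 4 * R < x \<and> x mod 3 = (4 * R + 1) mod 3}"

lemma sparse_config: "sparse t (config t R)"
  unfolding sparse_def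
proof (intro conjI ballI impI)
  fix p q assume "p \<in> config t R" "q \<in> config t R" "p < q"
  then consider "p mod 4 = 2" "q mod 4 = 2" | "p < 4 * R" "p mod 4 = 2" "4 * R < q"
    | "p mod 3 = q mod 3" by (auto simp: config_def)
  then show "p + 3 \<le> q"
  proof cases
    case 1
    then show ?thesis using mod_eq_imp_gap[of p 4 q] \<open>p < q\<close> by simp
  next
    case 2
    \<comment> \<open>Comparing with \<open>4 * R + 2\<close>, which has the same residue modulo 4,
      puts the last even element at \<open>4 * R - 2\<close> or lower.\<close>
    then have "p + 4 \<le> 4 * R + 2" by (intro mod_eq_imp_gap) (simp only: four_mult_add_two_mod, simp)
    then show ?thesis using 2 by simp
  next
    case 3
    then show ?thesis using mod_eq_imp_gap \<open>p < q\<close> by blast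
  qed
qed (auto simp: config_def)

text \<open>The least odd element, if any, is the break \<open>4 * R + 1\<close>: the even prefix
  lies below it and the chain of step 3 runs from it to \<open>t - 1\<close>, which fixes
  \<open>R\<close> modulo 3. If all elements are even, domination and one more exchange force the
  largest to be \<open>t - 1\<close> or \<open>t - 2\<close>.\<close>

lemma optimal_imp_config:
  assumes opt: "optimal t P" and t: "t \<ge> 6"
  shows "\<exists>R. R mod 3 = (t + 1) mod 3 \<and> 4 * R \<le> t + 4 \<and> P = config t R"
proof (cases "\<exists>x\<in>P. odd x")
  case True
  define p where "p = (LEAST x. x \<in> P \<and> odd x)"
  have p: "p \<in> P" "odd p" using True LeastI_ex[of "\<lambda>x. x \<in> P \<and> odd x"] by (auto simp: p_def)
  have least: "even x" if "x \<in> P" "x < p" for x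
    using that not_less_Least[of x "\<lambda>x. x \<in> P \<and> odd x"] by (auto simp: p_def)
  have prefix: "x mod 4 = 2" "y \<le> x \<Longrightarrow> y mod 4 = 2 \<Longrightarrow> y \<in> P" if "x \<in> P" "x < p" for x y
    using optimal_even_prefix[OF opt, of p x] least that by blast+
  note pb = optimal_bounds[OF opt p(1)]
  have p4: "p mod 4 = 1"
  proof (cases "3 \<le> p")
    case True
    then have "(p - 3) mod 4 = 2" using optimal_before_odd[OF opt p] by (intro prefix(1)) auto
    then obtain j where "p - 3 = 4 * j + 2" by (metis mult_div_mod_eq)
    then have "p = 1 + 4 * (j + 1)" using True by simp
    then show ?thesis by simp
  next
    case False
    then have "p = 1 \<or> p = 2" using pb by linarith
    then show ?thesis using p by auto
  qed
  define R where "R = p div 4"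
  have R: "p = 4 * R + 1" using div_mult_mod_eq[of p 4] p4 unfolding R_def by linarith
  have "P = config t R"
  proof (intro set_eqI iffI)
    fix x assume x: "x \<in> P"
    consider "x < p" | "p \<le> x" by linarith
    then show "x \<in> config t R"
    proof cases
      case 1
      then have "x mod 4 = 2" using prefix(1) x by blast
      moreover from this have "x < 4 * R" using 1 R by (cases "x = 4 * R") auto
      ultimately show ?thesis using optimal_bounds[OF opt x] by (simp add: config_def)
    next
      case 2
      define k where "k = (x - p) div 3"
      have k: "p + 3 * k \<le> x" "x < p + 3 * k + 3" using 2 by (auto simp: k_def)
      then have "p + 3 * k \<in> P"
        using optimal_chain(1)[OF opt p] optimal_bounds[OF opt x] by auto
      then have "x = p + 3 * k" using optimal_gap[OF opt x] k by fastforce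
      then show ?thesis using optimal_bounds[OF opt x] R by (auto simp: config_def)
    qed
  next
    fix x assume x: "x \<in> config t R"
    then consider "x < 4 * R" "x mod 4 = 2" | "4 * R < x" "x mod 3 = (4 * R + 1) mod 3"
      by (auto simp: config_def)
    then show "x \<in> P"
    proof cases
      case 1
      then have "x + 4 \<le> 4 * R + 2" by (intro mod_eq_imp_gap) (simp only: four_mult_add_two_mod, simp)
      then have "3 \<le> p" "x \<le> p - 3" using R by auto
      then show ?thesis using 1 optimal_before_odd[OF opt p] prefix(2)[of "p - 3" x] by auto
    next
      case 2
      then have "p mod 3 = x mod 3" "p \<le> x" using R by auto
      then obtain k where "x = p + 3 * k" by (rule mod_eq_nat2E)
      then show ?thesis using optimal_chain(1)[OF opt p, of k] x by (simp add: config_def)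
    qed
  qed
  moreover have "R mod 3 = (t + 1) mod 3"
  proof -
    obtain k where "p + 3 * k + 1 = t" using optimal_chain(2)[OF opt p] by blast
    then have "t + 1 = R + 3 * (R + k + 1)" using R by simp
    then show ?thesis by (metis mod_mult_self2)
  qed
  ultimately show ?thesis using R pb by (intro exI[of _ R]) auto
next
  case False
  have even: "even x" if "x \<in> P" for x using False that by blast
  have fin: "finite P" by (rule finite_sparse[OF optimal_sparse[OF opt]])
  have "P \<noteq> {}" using optimal_dominating[OF opt, of 1] t by auto
  define e where "e = Max P"
  have e: "e \<in> P" "\<And>x. x \<in> P \<Longrightarrow> x \<le> e" using fin \<open>P \<noteq> {}\<close> by (auto simp: e_def)
  note eb = optimal_bounds[OF opt e(1)]
  have pre: "x mod 4 = 2" "y \<le> x \<Longrightarrow> y mod 4 = 2 \<Longrightarrow> y \<in> P" if "x \<in> P" for x y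
  proof -
    have "x < t" using optimal_bounds[OF opt that] by blast
    then have "x mod 4 = 2 \<and> (\<forall>y\<le>x. y mod 4 = 2 \<longrightarrow> y \<in> P)"
      using optimal_even_prefix[OF opt even, of t x] that by blast
    then show "x mod 4 = 2" "y \<le> x \<Longrightarrow> y mod 4 = 2 \<Longrightarrow> y \<in> P" by blast+
  qed
  have "t \<le> e + 3"
  proof (rule ccontr)
    assume "\<not> ?thesis"
    then show False using optimal_dominating[OF opt, of "e + 3"] e(2) by force
  qed
  moreover have "t \<noteq> e + 3"
  proof
    assume te: "t = e + 3"
    then have "4 \<le> e" using t even[OF e(1)] by (cases "e = 3") auto
    \<comment> \<open>Since \<open>t = e + 3\<close>, the weight would rise from
      \<open>e + 7\<close> to \<open>2 * e + 4\<close>, a gain because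
      \<open>4 \<le> e\<close>.\<close>
    have "sum (weight t) {e - 1, e + 2} \<le> sum (weight t) {e}"
    proof (rule optimal_exchange[OF opt])
      fix q y assume q: "q \<in> P - {e}" "y \<in> {e - 1, e + 2}"
      have "q mod 4 = 2" "e mod 4 = 2" "q \<le> e" "q \<noteq> e" using pre(1) q e by auto
      then have "q + 4 \<le> e" by (intro mod_eq_imp_gap) auto
      then show "q + 3 \<le> y \<or> y + 3 \<le> q" using q by auto
    qed (use e te \<open>4 \<le> e\<close> in \<open>auto simp: sparse_def\<close>)
    then show False using even[OF e(1)] te \<open>4 \<le> e\<close> by (simp add: weight_odd weight_even)
  qed
  ultimately have te: "t = e + 1 \<or> t = e + 2" using eb by linarith
  have e4: "e mod 4 = 2" using pre e by blast
  \<comment> \<open>The first alternative is a break just past the end of the range; the second is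
    the degenerate value \<open>4 * R = t + 4\<close>.\<close>
  obtain R where R: "t = e + 1 \<and> 4 * R = e + 2 \<or> t = e + 2 \<and> 4 * R = e + 6"
  proof -
    obtain j where "e = 4 * j + 2" using e4 by (metis mult_div_mod_eq)
    then show ?thesis using te that[of "j + 1"] that[of "j + 2"] by auto
  qed
  have "P = config t R"
  proof (intro set_eqI iffI)
    fix x assume x: "x \<in> P"
    then show "x \<in> config t R" using pre(1)[OF x] e(2)[OF x] optimal_bounds[OF opt x] R
      by (auto simp: config_def)
  next
    fix x assume "x \<in> config t R"
    then have "x < t" "x mod 4 = 2" using R by (auto simp: config_def)
    then have "x \<le> e" using R e4 by (cases "x = e + 1") (auto simp: mod_Suc)
    note this \<open>x mod 4 = 2\<close>
    then show "x \<in> P" using pre(2)[OF e(1)] by blast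
  qed
  moreover have "t + 1 = R + 3 * R \<or> t + 1 = R + 3 * (R - 1)" using R by auto
  then have "R mod 3 = (t + 1) mod 3" by (metis mod_mult_self2)
  moreover have "4 * R \<le> t + 4" using R by linarith
  ultimately show ?thesis by blast
qed

section \<open>The weight of a candidate\<close>

lemma sum_weight_evens:
  "2 * R \<le> t + 1 \<Longrightarrow> (\<Sum>i<R. int (weight t (4 * i + 2))) = int R * (2 * int t + 1 - 2 * int R)"
proof (induction R)
  case (Suc R)
  have "int (weight t (4 * R + 2)) = 2 * int t - 1 - 4 * int R"
    using Suc.prems by (simp add: weight_def of_nat_diff)
  then show ?case using Suc by (simp add: algebra_simps)
qed simp

text \<open>An odd position followed by the even one 3 later contributes \<open>2 * t - 2\<close>
  wherever the pair lies; for odd \<open>k\<close> the last position remains unpaired.\<close>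

lemma sum_weight_alternating:
  assumes "4 * R + 3 * k \<le> 2 * t + 1"
  shows "(\<Sum>j<k. int (weight t (4 * R + 1 + 3 * j))) =
    (if even k then int k * (int t - 1) else (int k - 1) * (int t - 1) + 4 * int R + 3 * int k - 2)"
  using assms
proof (induction k)
  case (Suc k)
  have "int (weight t (4 * R + 1 + 3 * k)) =
    (if even k then 4 * int R + 1 + 3 * int k else 2 * int t - 4 * int R - 3 * int k)"
    using Suc.prems by (simp add: weight_def of_nat_diff)
  then show ?case using Suc by (simp add: algebra_simps)
qed simp

lemma sum_weight_config:
  assumes "R mod 3 = (t + 1) mod 3" "4 * R \<le> t + 4" "t \<ge> 6"
  shows "3 * int (sum (weight t) (config t R)) =
    (int t - 1) * (int t + 1 - 4 * int R) + 3 * int R * (2 * int t + 1 - 2 * int R)"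
proof -
  have "R \<le> t + 1" using assms(2,3) by linarith
  with assms(1) obtain s where s: "t + 1 = R + 3 * s" by (rule mod_eq_nat2E)
  show ?thesis
  proof (cases "4 * R \<le> t + 1")
    case True
    then obtain k where k: "t + 1 = 4 * R + 3 * k"
      using s that[of "s - R"] by auto
    have C: "config t R = (\<lambda>i. 4 * i + 2) ` {..<R} \<union> (\<lambda>j. 4 * R + 1 + 3 * j) ` {..<k}"
    proof (intro set_eqI iffI)
      fix x assume x: "x \<in> config t R"
      then consider "x < 4 * R" "x mod 4 = 2" | "4 * R < x" "x mod 3 = (4 * R + 1) mod 3"
        by (auto simp: config_def)
      then show "x \<in> (\<lambda>i. 4 * i + 2) ` {..<R} \<union> (\<lambda>j. 4 * R + 1 + 3 * j) ` {..<k}"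
      proof cases
        case 1
        then have "x = 4 * (x div 4) + 2" by (metis mult_div_mod_eq)
        moreover from this have "x div 4 < R" using 1 by linarith
        ultimately show ?thesis by blast
      next
        case 2
        then have "(4 * R + 1) mod 3 = x mod 3" "4 * R + 1 \<le> x" by auto
        then obtain j where j: "x = 4 * R + 1 + 3 * j" by (rule mod_eq_nat2E)
        then have "j < k" using x k by (auto simp: config_def)
        then show ?thesis using j by blast
      qed
    next
      fix x assume "x \<in> (\<lambda>i. 4 * i + 2) ` {..<R} \<union> (\<lambda>j. 4 * R + 1 + 3 * j) ` {..<k}"
      then consider i where "x = 4 * i + 2" "i < R" | j where "x = 4 * R + 1 + 3 * j" "j < k" by blast
      then show "x \<in> config t R"
      proof cases
        case 1
        then have "x < 4 * R" "x mod 4 = 2" "1 \<le> x" "x < t"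
          using k four_mult_add_two_mod[of i] by (simp_all only:)
        then show ?thesis by (auto simp: config_def)
      next
        case 2
        then show ?thesis using k by (auto simp: config_def)
      qed
    qed
    have "int (sum (weight t) (config t R)) =
      (\<Sum>i<R. int (weight t (4 * i + 2))) + (\<Sum>j<k. int (weight t (4 * R + 1 + 3 * j)))"
      unfolding C by (subst sum.union_disjoint) (auto simp: sum.reindex inj_on_def)
    also have "(\<Sum>j<k. int (weight t (4 * R + 1 + 3 * j))) = int k * (int t - 1)"
    proof -
      \<comment> \<open>The last chain position is \<open>t - 1\<close>, so an unpaired final
        element also weighs \<open>t - 1\<close> and both parities of \<open>k\<close> give the same
        total.\<close>
      have "4 * int R + 3 * int k - 2 = int t - 1" using k by linarith
      then show ?thesis using sum_weight_alternating[of R k t] k by (auto simp: algebra_simps)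
    qed
    also have "(\<Sum>i<R. int (weight t (4 * i + 2))) = int R * (2 * int t + 1 - 2 * int R)"
      using k by (intro sum_weight_evens) simp
    finally have s: "int (sum (weight t) (config t R)) =
      int R * (2 * int t + 1 - 2 * int R) + int k * (int t - 1)" .
    have "int t + 1 - 4 * int R = 3 * int k" using k by linarith
    then show ?thesis unfolding s by (simp add: algebra_simps)
  next
    \<comment> \<open>The congruence leaves only \<open>4 * R = t + 4\<close>, where the general
      formula persists as if \<open>k\<close> were -1.\<close>
    case False
    then have "R = s + 1" using s assms(2) by linarith
    then have tR: "4 * R = t + 4" using s by linarith
    define S where "S = R - 1"
    have S: "R = S + 1" "t = 4 * S" using tR by (auto simp: S_def)
    have "config t R = (\<lambda>i. 4 * i + 2) ` {..<S}"
    proof (intro set_eqI iffI)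
      fix x assume "x \<in> config t R"
      then have "x mod 4 = 2" "x < 4 * S" using S by (auto simp: config_def)
      then have "x = 4 * (x div 4) + 2" by (metis mult_div_mod_eq)
      moreover from this have "x div 4 < S" using \<open>x < 4 * S\<close> by linarith
      ultimately show "x \<in> (\<lambda>i. 4 * i + 2) ` {..<S}" by blast
    next
      fix x assume "x \<in> (\<lambda>i. 4 * i + 2) ` {..<S}"
      then obtain i where "x = 4 * i + 2" "i < S" by blast
      then have "x < 4 * R" "1 \<le> x" "x < t" using S by auto
      moreover have "x mod 4 = 2" using \<open>x = 4 * i + 2\<close> by (simp only: four_mult_add_two_mod)
      ultimately show "x \<in> config t R" by (auto simp: config_def)
    qed
    then have "int (sum (weight t) (config t R)) = (\<Sum>i<S. int (weight t (4 * i + 2)))"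
      by (simp add: sum.reindex inj_on_def)
    also have "\<dots> = int S * (2 * int t + 1 - 2 * int S)"
      using S by (intro sum_weight_evens) simp
    finally show ?thesis using S by (simp add: algebra_simps)
  qed
qed

text \<open>Tripled weights for \<open>R\<close> and \<open>S\<close> differ by
  \<open>(R - S) * (2 * t + 7 - 6 * R - 6 * S)\<close>. Competitors in the residue class are at
  least 3 away from \<open>R\<close>, which fixes the sign of the second factor; its vanishing is
  excluded because \<open>2 * t + 7\<close> is odd.\<close>

lemma optimal_unique:
  assumes t: "t \<ge> 6" and R: "R mod 3 = (t + 1) mod 3" "(2 * t + 1) div 12 \<le> R" "R \<le> (2 * t + 1) div 12 + 2"
  shows "optimal t P \<longleftrightarrow> P = config t R"
    and "3 * int (sum (weight t) (config t R)) =
      (int t - 1) * (int t + 1 - 4 * int R) + 3 * int R * (2 * int t + 1 - 2 * int R)"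
proof -
  define r where "r = (2 * t + 1) div 12"
  have r: "12 * r \<le> 2 * t + 1" "2 * t + 1 < 12 * r + 12" unfolding r_def by linarith+
  \<comment> \<open>The window for \<open>R\<close> alone gives this when
    \<open>(2 * t + 1) / 3 + 8 \<le> t + 4\<close>, that is for \<open>13 \<le> t\<close>; smaller
    \<open>t\<close> also need the residue.\<close>
  have b: "4 * R \<le> t + 4"
  proof (cases "13 \<le> t")
    case True
    then show ?thesis using r R(3) unfolding r_def[symmetric] by linarith
  next
    case False
    then have "t = 6 \<or> t = 7 \<or> t = 8 \<or> t = 9 \<or> t = 10 \<or> t = 11 \<or> t = 12" using t by linarith
    then show ?thesis using R(1,3) by (elim disjE; simp; presburger)
  qed
  show val: "3 * int (sum (weight t) (config t R)) =
      (int t - 1) * (int t + 1 - 4 * int R) + 3 * int R * (2 * int t + 1 - 2 * int R)"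
    by (rule sum_weight_config[OF R(1) b t])
  have only: "Q = config t R" if Q: "optimal t Q" for Q
  proof -
    obtain S where S: "S mod 3 = (t + 1) mod 3" "4 * S \<le> t + 4" "Q = config t S"
      using optimal_imp_config[OF Q t] by blast
    have "sum (weight t) (config t R) \<le> sum (weight t) Q"
      using Q sparse_config by (simp add: optimal_def)
    then have "3 * int (sum (weight t) (config t R)) \<le> 3 * int (sum (weight t) (config t S))"
      using S(3) by (simp del: of_nat_sum)
    then have "(int R - int S) * (2 * int t + 7 - 6 * int R - 6 * int S) \<le> 0"
      unfolding val sum_weight_config[OF S(1,2) t] by (simp add: algebra_simps)
    moreover have "0 < 2 * int t + 7 - 6 * int R - 6 * int S" if "S < R"
    proof -
      have "S + 3 \<le> R" using that S(1) R(1) by (intro mod_eq_imp_gap) auto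
      then have "6 * R + 6 * S \<le> 2 * t + 7"
        using R(3) r unfolding r_def[symmetric] by linarith
      moreover have "6 * R + 6 * S \<noteq> 2 * t + 7" by presburger
      ultimately have "int (6 * R + 6 * S) < int (2 * t + 7)" by (simp only: of_nat_less_iff)
      then show ?thesis by simp
    qed
    moreover have "2 * int t + 7 - 6 * int R - 6 * int S < 0" if "R < S"
    proof -
      have "R + 3 \<le> S" using that S(1) R(1) by (intro mod_eq_imp_gap) auto
      then have "2 * t + 7 < 6 * R + 6 * S" using R(2) r unfolding r_def[symmetric] by linarith
      then have "int (2 * t + 7) < int (6 * R + 6 * S)" by (simp only: of_nat_less_iff)
      then show ?thesis by simp
    qed
    ultimately have "S = R"
      by (cases S R rule: linorder_cases) (auto simp: mult_le_0_iff)
    then show ?thesis using S by simp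
  qed
  show "optimal t P \<longleftrightarrow> P = config t R" using only ex_optimal by metis
qed

section \<open>Transfer back to partitions, and small \<open>t\<close>\<close>

lemma max_size_optimal:
  assumes t: "t \<ge> 1" and opt: "optimal t P"
  shows "max_size t = sum (weight t) P"
proof -
  obtain \<phi> where phi: "bij_betw \<phi> (DS t) {P. sparse t P}"
    "\<And>l. l \<in> DS t \<Longrightarrow> sum_list l = sum (weight t) (\<phi> l)" using DS_bij_sparse[OF t] by blast
  have "sum_list ` DS t = sum (weight t) ` {P. sparse t P}"
    using phi by (metis (no_types, lifting) bij_betw_imp_surj_on image_cong image_image)
  moreover have "Max (sum (weight t) ` {P. sparse t P}) = sum (weight t) P"
    using opt finite_sparse_sets by (intro Max_eqI) (auto simp: optimal_def)
  ultimately show ?thesis by (simp add: max_size_def)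
qed

text \<open>A sparse set as heavy as \<open>P\<close> is itself optimal, hence equal to
  \<open>P\<close>; the bijection then gives exactly one partition.\<close>

lemma ex1_max_size:
  assumes t: "t \<ge> 1" and opt: "\<And>Q. optimal t Q \<longleftrightarrow> Q = P"
  shows "\<exists>!l. l \<in> DS t \<and> sum_list l = max_size t"
proof -
  obtain \<phi> where phi: "bij_betw \<phi> (DS t) {P. sparse t P}"
    "\<And>l. l \<in> DS t \<Longrightarrow> sum_list l = sum (weight t) (\<phi> l)" using DS_bij_sparse[OF t] by blast
  have P: "optimal t P" using opt by blast
  have "l \<in> DS t \<and> sum_list l = max_size t \<longleftrightarrow> l \<in> DS t \<and> \<phi> l = P" for l
  proof (cases "l \<in> DS t")
    case True
    then have "sparse t (\<phi> l)" using phi(1) by (auto simp: bij_betw_def)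
    then have "sum (weight t) (\<phi> l) = sum (weight t) P \<longleftrightarrow> optimal t (\<phi> l)"
      using P unfolding optimal_def by (metis le_antisym)
    then show ?thesis using True phi(2) max_size_optimal[OF t P] opt by simp
  qed simp
  moreover have "P \<in> {P. sparse t P}" using P by (simp add: optimal_def)
  then have "\<exists>!l. l \<in> DS t \<and> \<phi> l = P"
    using phi(1) unfolding bij_betw_def by (metis (no_types, lifting) imageE inj_onD)
  ultimately show ?thesis by simp
qed

lemma sparse_small:
  assumes "t \<le> 5" "sparse t P"
  shows "P = {1, 4} \<or> (\<exists>p. P \<subseteq> {p})"
proof (cases "\<exists>p. P \<subseteq> {p}")
  case False
  then obtain p q where pq: "p \<in> P" "q \<in> P" "q \<noteq> p" by blast
  have b: "1 \<le> x" "x \<le> 4" if "x \<in> P" for x using that assms by (auto simp: sparse_def)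
  have "p = 1 \<and> q = 4 \<or> p = 4 \<and> q = 1"
    using sparse_gap[OF assms(2) pq(1,2)] pq(3) b[OF pq(1)] b[OF pq(2)] by linarith
  then have in_P: "1 \<in> P" "4 \<in> P" using pq by auto
  moreover have "x = 1 \<or> x = 4" if "x \<in> P" for x
    using sparse_gap[OF assms(2) in_P(1) that] b[OF that] by linarith
  ultimately show ?thesis by blast
qed simp

text \<open>Position 2 carries the largest single weight \<open>2 * t - 1\<close>, and the only
  possible pair \<open>{1, 4}\<close> weighs one less.\<close>

lemma optimal_small:
  assumes "3 \<le> t" "t \<le> 5"
  shows "optimal t {2}"
  unfolding optimal_def
proof (intro conjI allI impI)
  show "sparse t {2}" using assms by (auto simp: sparse_def)
  fix Q assume Q: "sparse t Q"
  then have "Q = {1, 4} \<or> Q = {} \<or> (\<exists>p\<in>{1..<t}. Q = {p})"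
    using sparse_small[OF assms(2) Q] by (auto simp: sparse_def subset_singleton_iff)
  moreover have "weight t p \<le> weight t 2" if "p \<in> {1..<t}" for p
    using that by (auto simp: weight_def elim!: oddE evenE)
  ultimately show "sum (weight t) Q \<le> sum (weight t) {2}"
    using assms by (auto simp: weight_odd weight_even)
qed

theorem theorem1p3:
  fixes t :: nat
  assumes "t \<ge> 1"
  shows "(t = 1 \<longrightarrow> max_size t = 0) \<and>
    (t = 2 \<longrightarrow> max_size t = 1) \<and>
    (3 \<le> t \<and> t \<le> 5 \<longrightarrow> max_size t = 2 * t - 1) \<and>
    (t \<ge> 6 \<longrightarrow>
      (let r = \<lfloor>(2 * real t + 1) / 12\<rfloor>; \<rho> = real_of_int r in
        ((even t \<and> [int t div 2 - 1 - 2 * r = 0] (mod 3)) \<or>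
         (odd t \<and> [(int t - 1) div 2 - 2 * r = 2] (mod 3)) \<longrightarrow>
           real (max_size t) =
             1 / 3 * (real t - 1) * (real t + 1 - 4 * \<rho>) + \<rho> * (2 * real t + 1 - 2 * \<rho>)) \<and>
        ((even t \<and> [int t div 2 - 1 - 2 * r = 1] (mod 3)) \<or>
         (odd t \<and> [(int t - 1) div 2 - 2 * r = 0] (mod 3)) \<longrightarrow>
           real (max_size t) =
             1 / 3 * (real t - 1) * (real t - 7 - 4 * \<rho>) + (\<rho> + 2) * (2 * real t - 3 - 2 * \<rho>)) \<and>
        ((even t \<and> [int t div 2 - 1 - 2 * r = 2] (mod 3)) \<or>
         (odd t \<and> [(int t - 1) div 2 - 2 * r = 1] (mod 3)) \<longrightarrow>
           real (max_size t) =
             1 / 3 * (real t - 1) * (real t - 3 - 4 * \<rho>) + (\<rho> + 1) * (2 * real t - 1 - 2 * \<rho>)) \<and>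
        (\<exists>!l. l \<in> DS t \<and> sum_list l = max_size t)))"
proof (intro conjI impI)
  assume "t = 1"
  then have "optimal t {}" by (auto simp: optimal_def sparse_def)
  then show "max_size t = 0" using max_size_optimal[OF assms] by simp
next
  assume t: "t = 2"
  have "optimal t {1}"
    unfolding optimal_def
  proof (intro conjI allI impI)
    fix Q assume "sparse t Q"
    then have "Q \<subseteq> {1..<2}" using t by (simp add: sparse_def)
    also have "{1..<2} = {1::nat}" by auto
    finally have "Q = {} \<or> Q = {1}" by blast
    then show "sum (weight t) Q \<le> sum (weight t) {1}" by auto
  qed (use t in \<open>auto simp: sparse_def\<close>)
  then show "max_size t = 1" using max_size_optimal[OF assms] by (simp add: weight_odd)
next
  assume "3 \<le> t \<and> t \<le> 5"
  then have "optimal t {2}" using optimal_small by blast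
  then show "max_size t = 2 * t - 1" using max_size_optimal[OF assms] by (simp add: weight_even)
next
  assume t: "6 \<le> t"
  define r where "r = (2 * t + 1) div 12"
  have floor: "\<lfloor>(2 * real t + 1) / 12\<rfloor> = int r"
    using floor_divide_of_nat_eq[of "2 * t + 1" 12] by (simp add: r_def algebra_simps)
  have val: "real (max_size t) = 1 / 3 * (real t - 1) * (real t + 1 - 4 * real R) +
      real R * (2 * real t + 1 - 2 * real R)"
    if R: "R mod 3 = (t + 1) mod 3" "r \<le> R" "R \<le> r + 2" for R
  proof -
    have "max_size t = sum (weight t) (config t R)"
      using max_size_optimal[OF assms] optimal_unique(1)[OF t R[unfolded r_def]] by blast
    then have "3 * int (max_size t) =
        (int t - 1) * (int t + 1 - 4 * int R) + 3 * int R * (2 * int t + 1 - 2 * int R)"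
      using optimal_unique(2)[OF t R[unfolded r_def]] by simp
    then have "real_of_int (3 * int (max_size t)) =
        real_of_int ((int t - 1) * (int t + 1 - 4 * int R) + 3 * int R * (2 * int t + 1 - 2 * int R))"
      by (simp only:)
    then show ?thesis by (simp add: field_simps)
  qed
  \<comment> \<open>The parameter \<open>c\<close> is the residue in the even case. The values 0, 1,
    2 lead to \<open>R = r\<close>, \<open>r + 2\<close>, \<open>r + 1\<close>, and substituting
    these into \<open>val\<close> gives the three stated formulas.\<close>
  have residue: "R mod 3 = (t + 1) mod 3"
    if "even t \<and> [int t div 2 - 1 - 2 * int r = c] (mod 3) \<or>
        odd t \<and> [(int t - 1) div 2 - 2 * int r = c + 2] (mod 3)"
      "[int R = int r - c] (mod 3)" for R c
    using that(1)
  proof (elim disjE conjE)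
    assume "even t" and c: "[int t div 2 - 1 - 2 * int r = c] (mod 3)"
    then obtain u where "t = 2 * u" by blast
    \<comment> \<open>The added multiple of 3 makes \<open>r\<close> and \<open>c\<close> cancel and
      leaves \<open>R - (t + 1)\<close>.\<close>
    with c that(2) have "3 dvd (int u - 1 - 2 * int r - c) + (int R - (int r - c)) + 3 * (int r - int u)"
      by (intro dvd_add) (auto simp: cong_iff_dvd_diff)
    also have "\<dots> = int R - int (t + 1)" using \<open>t = 2 * u\<close> by simp
    finally have "[int R = int (t + 1)] (mod 3)" by (simp only: cong_iff_dvd_diff)
    then have "int (R mod 3) = int ((t + 1) mod 3)" by (simp add: cong_def zmod_int)
    then show ?thesis by (simp only: of_nat_eq_iff)
  next
    assume "odd t" and c: "[(int t - 1) div 2 - 2 * int r = c + 2] (mod 3)"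
    then obtain u where "t = 2 * u + 1" by (auto elim: oddE)
    with c that(2) have "3 dvd (int u - 2 * int r - (c + 2)) + (int R - (int r - c)) + 3 * (int r - int u)"
      by (intro dvd_add) (auto simp: cong_iff_dvd_diff)
    also have "\<dots> = int R - int (t + 1)" using \<open>t = 2 * u + 1\<close> by simp
    finally have "[int R = int (t + 1)] (mod 3)" by (simp only: cong_iff_dvd_diff)
    then have "int (R mod 3) = int ((t + 1) mod 3)" by (simp add: cong_def zmod_int)
    then show ?thesis by (simp only: of_nat_eq_iff)
  qed
  show "let r = \<lfloor>(2 * real t + 1) / 12\<rfloor>; \<rho> = real_of_int r in
        ((even t \<and> [int t div 2 - 1 - 2 * r = 0] (mod 3)) \<or>
         (odd t \<and> [(int t - 1) div 2 - 2 * r = 2] (mod 3)) \<longrightarrow>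
           real (max_size t) =
             1 / 3 * (real t - 1) * (real t + 1 - 4 * \<rho>) + \<rho> * (2 * real t + 1 - 2 * \<rho>)) \<and>
        ((even t \<and> [int t div 2 - 1 - 2 * r = 1] (mod 3)) \<or>
         (odd t \<and> [(int t - 1) div 2 - 2 * r = 0] (mod 3)) \<longrightarrow>
           real (max_size t) =
             1 / 3 * (real t - 1) * (real t - 7 - 4 * \<rho>) + (\<rho> + 2) * (2 * real t - 3 - 2 * \<rho>)) \<and>
        ((even t \<and> [int t div 2 - 1 - 2 * r = 2] (mod 3)) \<or>
         (odd t \<and> [(int t - 1) div 2 - 2 * r = 1] (mod 3)) \<longrightarrow>
           real (max_size t) =
             1 / 3 * (real t - 1) * (real t - 3 - 4 * \<rho>) + (\<rho> + 1) * (2 * real t - 1 - 2 * \<rho>)) \<and>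
        (\<exists>!l. l \<in> DS t \<and> sum_list l = max_size t)"
    unfolding floor Let_def of_int_of_nat_eq
  proof (intro conjI impI)
    assume "even t \<and> [int t div 2 - 1 - 2 * int r = 0] (mod 3) \<or>
        odd t \<and> [(int t - 1) div 2 - 2 * int r = 2] (mod 3)"
    then have "r mod 3 = (t + 1) mod 3" by (intro residue[where c = 0]) auto
    then show "real (max_size t) = 1 / 3 * (real t - 1) * (real t + 1 - 4 * real r) +
        real r * (2 * real t + 1 - 2 * real r)" by (rule val) auto
  next
    assume "even t \<and> [int t div 2 - 1 - 2 * int r = 1] (mod 3) \<or>
        odd t \<and> [(int t - 1) div 2 - 2 * int r = 0] (mod 3)"
    then have "even t \<and> [int t div 2 - 1 - 2 * int r = 1] (mod 3) \<or>
        odd t \<and> [(int t - 1) div 2 - 2 * int r = 1 + 2] (mod 3)"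
      by (auto simp: cong_def)
    moreover have "[int (r + 2) = int r - 1] (mod 3)" by (simp add: cong_iff_dvd_diff)
    ultimately have "(r + 2) mod 3 = (t + 1) mod 3" by (rule residue)
    from val[OF this] show "real (max_size t) = 1 / 3 * (real t - 1) * (real t - 7 - 4 * real r) +
        (real r + 2) * (2 * real t - 3 - 2 * real r)" by (simp add: algebra_simps)
  next
    assume "even t \<and> [int t div 2 - 1 - 2 * int r = 2] (mod 3) \<or>
        odd t \<and> [(int t - 1) div 2 - 2 * int r = 1] (mod 3)"
    then have "even t \<and> [int t div 2 - 1 - 2 * int r = 2] (mod 3) \<or>
        odd t \<and> [(int t - 1) div 2 - 2 * int r = 2 + 2] (mod 3)"
      by (auto simp: cong_def)
    moreover have "[int (r + 1) = int r - 2] (mod 3)" by (simp add: cong_iff_dvd_diff)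
    ultimately have "(r + 1) mod 3 = (t + 1) mod 3" by (rule residue)
    from val[OF this] show "real (max_size t) = 1 / 3 * (real t - 1) * (real t - 3 - 4 * real r) +
        (real r + 1) * (2 * real t - 1 - 2 * real r)" by (simp add: algebra_simps)
  next
    \<comment> \<open>This is the representative of \<open>t + 1\<close> modulo 3 among
      \<open>r\<close>, \<open>r + 1\<close>, \<open>r + 2\<close>, so uniqueness is settled for all
      three cases at once.\<close>
    define R where "R = r + (t + 1 + 2 * r) mod 3"
    have "R mod 3 = (t + 1 + 3 * r) mod 3" by (simp add: R_def mod_add_right_eq algebra_simps)
    then have R: "R mod 3 = (t + 1) mod 3" "r \<le> R" "R \<le> r + 2"
      using mod_less_divisor[of 3 "t + 1 + 2 * r"] by (auto simp: R_def)
    show "\<exists>!l. l \<in> DS t \<and> sum_list l = max_size t"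
      by (rule ex1_max_size[OF assms optimal_unique(1)[OF t R[unfolded r_def]]])
  qed
qed

end
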